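(* Let $\Vert \cdot \Vert: \mathbb{R}^n \to \mathbb{R}_{\geq 0}$ be a norm and let $\Lambda \subseteq \mathbb{R}^n$ be a lattice. For every lattice vector $v \in \Lambda$ which is Voronoi-relevant with respect to $\Vert \cdot \Vert$, the set $\mathcal{V}(\Lambda, \Vert \cdot \Vert) \cap \mathcal{H}_{\Vert \cdot \Vert}^{=}(0,v)$ is a facet of the Voronoi cell $\mathcal{V}(\Lambda, \Vert \cdot \Vert)$.
   Context: A lattice $\Lambda \subseteq \mathbb{R}^n$ is a discrete additive subgroup of $\mathbb{R}^n$; all lattices are assumed to have full rank $n$, i.e. $\Lambda$ spans $\mathbb{R}^n$ over $\mathbb{R}$. The Voronoi cell is $\mathcal{V}(\Lambda, \Vert \cdot \Vert) := \{ x \in \mathbb{R}^n \mid \forall v \in \Lambda: \Vert x \Vert \leq \Vert x-v \Vert \}$. A vector $v \in \Lambda \setminus \{0\}$ is Voronoi-relevant (with respect to $\Vert\cdot\Vert$) if there is some $x \in \mathbb{R}^n$ such that $\Vert x \Vert = \Vert x-v \Vert < \Vert x-w \Vert$ for all $w \in \Lambda \setminus \{0,v\}$. For distinct $a,b \in \mathbb{R}^n$, the bisector is $\mathcal{H}_{\Vert \cdot \Vert}^{=}(a,b) := \{ x \in \mathbb{R}^n \mid \Vert x-a \Vert = \Vert x-b \Vert \}$. For $\delta>0$, $\mathcal{B}_{\Vert \cdot \Vert_2, \delta}(x) := \{ y \in \mathbb{R}^n \mid \Vert y-x \Vert_2 < \delta \}$ is the open Euclidean ball. A facet of the Voronoi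 cell is a subset $\mathcal{F} \subseteq \mathcal{V}(\Lambda, \Vert \cdot \Vert)$ such that: (1) there is $v \in \Lambda \setminus \{0\}$ with $\mathcal{F} = \mathcal{V}(\Lambda, \Vert \cdot \Vert) \cap \mathcal{H}_{\Vert \cdot \Vert}^{=}(0,v)$; (2) for this $v$, there are $x \in \mathcal{F}$ and $\delta \in \mathbb{R}_{>0}$ with $\mathcal{B}_{\Vert \cdot \Vert_2, \delta}(x) \cap \mathcal{H}_{\Vert \cdot \Vert}^{=}(0,v) \subseteq \mathcal{F}$; (3) there is no $w \in \Lambda \setminus \{0\}$ such that $\mathcal{F} \subsetneqq \mathcal{V}(\Lambda, \Vert \cdot \Vert) \cap \mathcal{H}_{\Vert \cdot \Vert}^{=}(0,w)$. *)

theory Defs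
  imports "HOL-Analysis.Analysis"
begin

text \<open>
  The norm under consideration is an arbitrary norm, passed as a parameter \<open>N\<close>;
  the type-class constant \<^const>\<open>norm\<close> on \<^typ>\<open>real ^ 'n\<close> is the Euclidean norm.
\<close>

definition is_norm :: "(real ^ 'n \<Rightarrow> real) \<Rightarrow> bool" where
  "is_norm N \<longleftrightarrow>
     (\<forall>x. 0 \<le> N x) \<and>
     (\<forall>x. N x = 0 \<longleftrightarrow> x = 0) \<and>
     (\<forall>c x. N (c *\<^sub>R x) = \<bar>c\<bar> * N x) \<and>
     (\<forall>x y. N (x + y) \<le> N x + N y)"

definition is_lattice :: "(real ^ 'n) set \<Rightarrow> bool" where
  "is_lattice L \<longleftrightarrow>
     0 \<in> L \<and> (\<forall>x\<in>L. \<forall>y\<in>L. x + y \<in> L) \<and> (\<forall>x\<in>L. - x \<in> L) \<and>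
     discrete L \<and> span L = UNIV"

definition voronoi_cell :: "(real ^ 'n) set \<Rightarrow> (real ^ 'n \<Rightarrow> real) \<Rightarrow> (real ^ 'n) set" where
  "voronoi_cell L N = {x. \<forall>v\<in>L. N x \<le> N (x - v)}"

definition voronoi_relevant ::
    "(real ^ 'n) set \<Rightarrow> (real ^ 'n \<Rightarrow> real) \<Rightarrow> real ^ 'n \<Rightarrow> bool" where
  "voronoi_relevant L N v \<longleftrightarrow>
     v \<in> L - {0} \<and> (\<exists>x. N x = N (x - v) \<and> (\<forall>w \<in> L - {0, v}. N (x - v) < N (x - w)))"

definition bisector :: "(real ^ 'n \<Rightarrow> real) \<Rightarrow> real ^ 'n \<Rightarrow> real ^ 'n \<Rightarrow> (real ^ 'n) set" where
  "bisector N a b = {x. N (x - a) = N (x - b)}"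

text \<open>\<^const>\<open>ball\<close> is the open Euclidean ball, independently of \<open>N\<close>.\<close>

definition voronoi_facet ::
    "(real ^ 'n) set \<Rightarrow> (real ^ 'n \<Rightarrow> real) \<Rightarrow> (real ^ 'n) set \<Rightarrow> bool" where
  "voronoi_facet L N F \<longleftrightarrow>
     F \<subseteq> voronoi_cell L N \<and>
     (\<exists>v \<in> L - {0}.
        F = voronoi_cell L N \<inter> bisector N 0 v \<and>
        (\<exists>x\<in>F. \<exists>\<delta>>0. ball x \<delta> \<inter> bisector N 0 v \<subseteq> F)) \<and>
     \<not> (\<exists>w \<in> L - {0}. F \<subset> voronoi_cell L N \<inter> bisector N 0 w)"

end

theory Submission
  imports Defs
begin

text \<open>
  Let \<open>x\<close> witness that \<open>v\<close> is Voronoi-relevant. By discreteness, the strict inequalities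
  \<open>N x < N (x - w)\<close> hold with a gap \<open>g\<close> uniform in \<open>w\<close>, so they persist on a Euclidean ball
  around \<open>x\<close> on which \<open>N (x - y) < g / 2\<close>; this gives condition (2). For condition (3), a set
  \<open>bisector N 0 w\<close> containing \<open>x\<close> forces \<open>w = v\<close>.
\<close>

lemma is_norm_nonneg: "is_norm N \<Longrightarrow> 0 \<le> N x"
  and is_norm_eq_0_iff: "is_norm N \<Longrightarrow> N x = 0 \<longleftrightarrow> x = 0"
  and is_norm_scaleR: "is_norm N \<Longrightarrow> N (c *\<^sub>R x) = \<bar>c\<bar> * N x"
  and is_norm_triangle: "is_norm N \<Longrightarrow> N (x + y) \<le> N x + N y"
  by (auto simp: is_norm_def)

lemma is_norm_minus: "is_norm N \<Longrightarrow> N (- x) = N x"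
  using is_norm_scaleR[of N "-1" x] by simp

text \<open>Triangle inequality and homogeneity make \<open>N\<close> convex, and a finite convex
  function on a finite-dimensional space is continuous.\<close>

lemma is_norm_continuous_on:
  assumes "is_norm N"
  shows "continuous_on S N"
proof -
  have "convex_on UNIV N"
  proof (rule convex_onI)
    fix t :: real and x y
    assume t: "0 < t" "t < 1"
    have "N ((1 - t) *\<^sub>R x + t *\<^sub>R y) \<le> N ((1 - t) *\<^sub>R x) + N (t *\<^sub>R y)"
      by (rule is_norm_triangle[OF assms])
    then show "N ((1 - t) *\<^sub>R x + t *\<^sub>R y) \<le> (1 - t) * N x + t * N y"
      using t by (simp add: is_norm_scaleR[OF assms])
  qed simp
  then have "continuous_on UNIV N"
    by (intro convex_on_continuous) auto
  then show ?thesis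
    by (rule continuous_on_subset) simp
qed

text \<open>One half of the equivalence of norms: \<open>c\<close> is the minimum of
  \<open>N\<close> on the Euclidean unit sphere, attained by compactness and positive because 0 is
  not on the sphere. Homogeneity carries the bound to all \<open>x\<close>.\<close>

lemma is_norm_bounded_below:
  fixes N :: "real ^ 'n \<Rightarrow> real"
  assumes "is_norm N"
  obtains c where "0 < c" "\<And>x. c * norm x \<le> N x"
proof -
  have "\<exists>z\<in>sphere (0 :: real ^ 'n) 1. \<forall>y\<in>sphere 0 1. N z \<le> N y"
    by (intro continuous_attains_inf is_norm_continuous_on[OF assms]) auto
  then obtain z where z: "norm z = 1" and min: "\<And>y. norm y = 1 \<Longrightarrow> N z \<le> N y"
    by auto
  have "z \<noteq> 0"
    using z by auto
  then have "0 < N z"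
    using is_norm_nonneg[OF assms, of z] is_norm_eq_0_iff[OF assms, of z] by linarith
  moreover have "N z * norm x \<le> N x" for x
  proof (cases "x = 0")
    case True
    then show ?thesis
      using is_norm_nonneg[OF assms] by simp
  next
    case False
    then have "N z \<le> N ((1 / norm x) *\<^sub>R x)"
      by (intro min) simp
    then show ?thesis
      using False by (simp add: is_norm_scaleR[OF assms] field_simps)
  qed
  ultimately show ?thesis
    by (rule that)
qed

text \<open>The group structure moves the isolation radius at 0 to every point: two points closer
  than \<open>e\<close> have a difference in \<open>L\<close> closer than \<open>e\<close> to
  0.\<close>

lemma is_lattice_uniform_discrete:
  assumes "is_lattice L"
  shows "uniform_discrete L"
proof -
  have "0 isolated_in L"
    using assms by (auto simp: is_lattice_def discrete_def)
  then obtain e where e: "0 < e" "\<And>y. y \<in> L \<Longrightarrow> dist 0 y < e \<Longrightarrow> y = 0"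
    by (rule isolated_inE_dist) blast
  show ?thesis
  proof (rule uniformI1[OF e(1)])
    fix x y assume xy: "x \<in> L" "y \<in> L" "dist x y < e"
    then have "x - y \<in> L"
      using assms unfolding is_lattice_def by (metis diff_conv_add_uminus)
    with xy(3) have "x - y = 0"
      by (intro e(2)) (simp_all add: dist_norm norm_minus_commute)
    then show "x = y"
      by simp
  qed
qed

text \<open>Uniform discreteness gives closedness, so a bounded such set is compact, and a compact
  discrete set is finite.\<close>

lemma uniform_discrete_bounded_imp_finite:
  fixes S :: "'a::heine_borel set"
  assumes "uniform_discrete S" "bounded S"
  shows "finite S"
  using assms discrete_compact_finite_iff[of S]
  by (simp add: compact_eq_bounded_closed uniform_discrete_imp_closed
      uniform_discrete_imp_discrete)

text \<open>The lower bound of \<open>N\<close> by a multiple of the Euclidean norm puts the set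
  into a Euclidean ball of radius \<open>r / c\<close> around \<open>x\<close>.\<close>

lemma finite_lattice_norm_le:
  assumes N: "is_norm N" and L: "is_lattice L"
  shows "finite {w \<in> L. N (x - w) \<le> r}"
proof (rule uniform_discrete_bounded_imp_finite)
  show "uniform_discrete {w \<in> L. N (x - w) \<le> r}"
    by (rule uniform_discrete_subset[OF is_lattice_uniform_discrete[OF L]]) auto
  obtain c where c: "0 < c" "\<And>x. c * norm x \<le> N x"
    using is_norm_bounded_below[OF N] by blast
  have "dist x w \<le> r / c" if "N (x - w) \<le> r" for w
    using c(1) c(2)[of "x - w"] that by (simp add: dist_norm field_simps)
  then show "bounded {w \<in> L. N (x - w) \<le> r}"
    by (auto simp: bounded_def)
qed

lemma uniform_lattice_gap:
  assumes "is_norm N" "is_lattice L" "W \<subseteq> L"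
    and "\<And>w. w \<in> W \<Longrightarrow> r < N (x - w)"
  obtains g where "0 < g" "\<And>w. w \<in> W \<Longrightarrow> r + g \<le> N (x - w)"
proof -
  \<comment> \<open>Only finitely many \<open>w\<close> satisfy
    \<open>N (x - w) \<le> r + 1\<close>. The element 1 is a valid gap for all the others, and it
    keeps \<open>D\<close> nonempty for \<open>Min\<close>.\<close>
  define D where "D = insert 1 ((\<lambda>w. N (x - w) - r) ` {w \<in> W. N (x - w) \<le> r + 1})"
  have "finite {w \<in> W. N (x - w) \<le> r + 1}"
    by (rule finite_subset[OF _ finite_lattice_norm_le[OF assms(1,2), of x "r + 1"]])
      (use assms(3) in auto)
  then have D: "finite D" "D \<noteq> {}"
    by (auto simp: D_def)
  show ?thesis
  proof (rule that)
    show "0 < Min D"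
      using D assms(4) by (auto simp: D_def)
    fix w assume w: "w \<in> W"
    have "Min D \<le> 1"
      using D by (intro Min_le) (auto simp: D_def)
    moreover have "Min D \<le> N (x - w) - r" if "N (x - w) \<le> r + 1"
      using D w that by (intro Min_le) (auto simp: D_def)
    ultimately show "r + Min D \<le> N (x - w)"
      by linarith
  qed
qed

lemma is_norm_small_on_ball:
  assumes "is_norm N" "0 < e"
  obtains d where "0 < d" "\<And>y. y \<in> ball x d \<Longrightarrow> N (x - y) < e"
proof -
  have "continuous_on UNIV (\<lambda>y. N (x - y))"
    by (rule continuous_on_compose2[OF is_norm_continuous_on[OF assms(1), of UNIV]])
      (auto intro!: continuous_intros)
  then have "open {y. N (x - y) < e}"
    by (intro open_Collect_less) auto
  moreover have "x \<in> {y. N (x - y) < e}"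
    using assms is_norm_eq_0_iff[OF assms(1), of 0] by simp
  ultimately obtain d where "0 < d" "ball x d \<subseteq> {y. N (x - y) < e}"
    by (meson open_contains_ball)
  then show ?thesis
    by (intro that[of d]) auto
qed

theorem proposition5:
  fixes N :: "real ^ 'n \<Rightarrow> real" and L :: "(real ^ 'n) set"
  assumes "is_norm N"
    and "is_lattice L"
  shows "\<forall>v\<in>L. voronoi_relevant L N v \<longrightarrow>
           voronoi_facet L N (voronoi_cell L N \<inter> bisector N 0 v)"
proof (intro ballI impI)
  fix v assume "v \<in> L" and "voronoi_relevant L N v"
  then obtain x where v: "v \<in> L - {0}" and x_eq: "N x = N (x - v)"
    and x_less: "\<And>w. w \<in> L - {0, v} \<Longrightarrow> N x < N (x - w)"
    unfolding voronoi_relevant_def by auto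
  let ?F = "voronoi_cell L N \<inter> bisector N 0 v"
  have "N x \<le> N (x - w)" if "w \<in> L" for w
    using x_eq x_less[of w] that by (cases "w \<in> {0, v}") auto
  then have xF: "x \<in> ?F"
    using x_eq by (simp add: voronoi_cell_def bisector_def)
  obtain g where g: "0 < g" "\<And>w. w \<in> L - {0, v} \<Longrightarrow> N x + g \<le> N (x - w)"
    using uniform_lattice_gap[OF assms, of "L - {0, v}" "N x" x] x_less by blast
  obtain d where d: "0 < d" "\<And>y. y \<in> ball x d \<Longrightarrow> N (x - y) < g / 2"
    using is_norm_small_on_ball[OF assms(1), of "g / 2" x] g(1) by auto
  have "ball x d \<inter> bisector N 0 v \<subseteq> ?F"
  proof
    fix y assume y: "y \<in> ball x d \<inter> bisector N 0 v"
    then have y_eq: "N y = N (y - v)"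
      by (simp add: bisector_def)
    have "N y \<le> N (y - w)" if w: "w \<in> L" for w
    proof (cases "w \<in> {0, v}")
      case True
      then show ?thesis
        using y_eq by auto
    next
      case False
      \<comment> \<open>Passing from \<open>x\<close> to \<open>y\<close> raises the left side and
        lowers the right side by less than \<open>g / 2\<close> each, so the gap \<open>g\<close>
        covers both losses.\<close>
      have "N y \<le> N x + N (x - y)"
        using is_norm_triangle[OF assms(1), of x "y - x"] is_norm_minus[OF assms(1), of "x - y"]
        by simp
      moreover have "N (x - w) \<le> N (x - y) + N (y - w)"
        using is_norm_triangle[OF assms(1), of "x - y" "y - w"] by simp
      moreover have "N (x - y) < g / 2"
        using y d(2) by simp
      moreover have "N x + g \<le> N (x - w)"
        using g(2) w False by simp
      ultimately show ?thesis
        by linarith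
    qed
    then show "y \<in> ?F"
      using y by (simp add: voronoi_cell_def)
  qed
  moreover have "\<not> ?F \<subset> voronoi_cell L N \<inter> bisector N 0 w" if w: "w \<in> L - {0}" for w
  proof
    assume sub: "?F \<subset> voronoi_cell L N \<inter> bisector N 0 w"
    then have "N x = N (x - w)"
      using xF by (auto simp: bisector_def)
    \<comment> \<open>At \<open>x\<close> equality is excluded for every nonzero \<open>w\<close>
      other than \<open>v\<close>; for \<open>w = v\<close> the inclusion would not be
      proper.\<close>
    then have "w = v"
      using x_less[of w] w by fastforce
    then show False
      using sub by simp
  qed
  ultimately show "voronoi_facet L N ?F"
    unfolding voronoi_facet_def using v xF d(1) by blast
qed

end
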